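(* For every $m\ge 3$, the Sperner systems $\mathcal{M}^m_1$ and $\mathcal{M}^m_2$ are nonisomorphic.
   Context: A set system over a finite set $A$ (the ground set) is a set of subsets of $A$, called blocks; it is a Sperner system if no block is included in another. Set systems $\mathcal A$ over $A$ and $\mathcal B$ over $B$ are isomorphic if there is a bijection $\sigma\colon A\to B$ with $\{\sigma(S):S\in\mathcal A\}=\mathcal B$. Let $[m]=\{1,\dots,m\}$. For each $n\in[m]$ let $n'$ be a new element (a primed copy of $n$), and $S'=\{n':n\in S\}$ for $S\subseteq[m]$. Let $E_m=[m]\cup[m]'$, a set with $2m$ elements. Addition of elements of $[m]$ is modulo $m$ with result taken in $[m]$. For $J\subseteq[m]$ let $F^m_J=J\cup([m]\setminus J)'$. Put $\mathcal F^m_1=\{F^m_J: J\subseteq[m],\ |J|\text{ odd}\}$ and $\mathcal F^m_2=\{F^m_J: J\subseteq[m],\ |J|\text{ even}\}$. For $p\in[m]$ let $G^m_p=E_m\setminus\{p,p',(p+1)'\}$ and $\mathcal G^m=\{G^m_p:p\in[m]\}$. For $i\in\{1,2\}$, $\mathcal M^m_i=\mathcal F^m_i\cup\mathcal G^m$, a Sperner system over $E_m$. *)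

theory Defs
  imports Main
begin

definition set_system :: "'a set \<Rightarrow> 'a set set \<Rightarrow> bool" where
  "set_system A \<A> \<longleftrightarrow> finite A \<and> \<A> \<subseteq> Pow A"

definition sperner_system :: "'a set \<Rightarrow> 'a set set \<Rightarrow> bool" where
  "sperner_system A \<A> \<longleftrightarrow> set_system A \<A> \<and> (\<forall>S\<in>\<A>. \<forall>T\<in>\<A>. S \<subseteq> T \<longrightarrow> S = T)"

definition isomorphic_systems :: "'a set \<Rightarrow> 'a set set \<Rightarrow> 'b set \<Rightarrow> 'b set set \<Rightarrow> bool" where
  "isomorphic_systems A \<A> B \<B> \<longleftrightarrow> (\<exists>\<sigma>. bij_betw \<sigma> A B \<and> {\<sigma> ` S | S. S \<in> \<A>} = \<B>)"

text \<open>The element \<open>n\<close> of \<open>[m]\<close> is encoded as \<open>Inl n\<close> and its primed copy \<open>n'\<close> as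
  \<open>Inr n\<close>; hence \<open>S \<union> T'\<close> for \<open>S, T \<subseteq> [m]\<close> is the disjoint sum \<open>S <+> T\<close>.\<close>

definition ground :: "nat \<Rightarrow> (nat + nat) set" where
  "ground m = {1..m} <+> {1..m}"

text \<open>The representative of \<open>a + b\<close> modulo \<open>m\<close> in \<open>{1..m}\<close> (so \<open>m\<close> plays the role of \<open>0\<close>),
  for \<open>a, b \<in> {1..m}\<close>.\<close>

definition cyc_add :: "nat \<Rightarrow> nat \<Rightarrow> nat \<Rightarrow> nat" where
  "cyc_add m a b = (a + b - 1) mod m + 1"

definition F_block :: "nat \<Rightarrow> nat set \<Rightarrow> (nat + nat) set" where
  "F_block m J = J <+> ({1..m} - J)"

definition F1 :: "nat \<Rightarrow> (nat + nat) set set" where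
  "F1 m = {F_block m J | J. J \<subseteq> {1..m} \<and> odd (card J)}"

definition F2 :: "nat \<Rightarrow> (nat + nat) set set" where
  "F2 m = {F_block m J | J. J \<subseteq> {1..m} \<and> even (card J)}"

definition G_block :: "nat \<Rightarrow> nat \<Rightarrow> (nat + nat) set" where
  "G_block m p = ground m - {Inl p, Inr p, Inr (cyc_add m p 1)}"

definition G :: "nat \<Rightarrow> (nat + nat) set set" where
  "G m = {G_block m p | p. p \<in> {1..m}}"

definition M1 :: "nat \<Rightarrow> (nat + nat) set set" where
  "M1 m = F1 m \<union> G m"

definition M2 :: "nat \<Rightarrow> (nat + nat) set set" where
  "M2 m = F2 m \<union> G m"

lemma sperner_system_blocks:
  assumes "m \<ge> 3" and sub: "\<A> \<subseteq> {F_block m J | J. J \<subseteq> {1..m}}"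
  shows "sperner_system (ground m) (\<A> \<union> G m)"
proof -
  have FF: "J = K" if "J \<subseteq> {1..m}" "K \<subseteq> {1..m}" "F_block m J \<subseteq> F_block m K" for J K
  proof -
    have "J \<subseteq> K"
    proof
      fix x assume "x \<in> J"
      then have "Inl x \<in> F_block m J" by (auto simp: F_block_def)
      then have "Inl x \<in> F_block m K" using that(3) by blast
      then show "x \<in> K" by (auto simp: F_block_def)
    qed
    moreover have "K \<subseteq> J"
    proof
      fix x assume "x \<in> K"
      then have "Inr x \<notin> F_block m K" by (auto simp: F_block_def)
      then have "Inr x \<notin> F_block m J" using that(3) by blast
      then show "x \<in> J" using \<open>x \<in> K\<close> that(2) by (auto simp: F_block_def)
    qed
    ultimately show ?thesis by (rule subset_antisym)
  qed
  have FG: "\<not> F_block m J \<subseteq> G_block m p" if "p \<in> {1..m}" for J p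
  proof -
    have "Inl p \<in> F_block m J \<or> Inr p \<in> F_block m J"
      using that by (auto simp: F_block_def)
    moreover have "Inl p \<notin> G_block m p" "Inr p \<notin> G_block m p"
      by (simp_all add: G_block_def)
    ultimately show ?thesis by blast
  qed
  have GF: "\<not> G_block m p \<subseteq> F_block m J" if "p \<in> {1..m}" for J p
  proof -
    have "card {p, cyc_add m p 1} \<le> 2"
      by (simp add: card_insert_if)
    then have "\<not> {1..m} \<subseteq> {p, cyc_add m p 1}"
      using assms(1) card_mono[of "{p, cyc_add m p 1}" "{1..m}"] by auto
    then obtain n where n: "n \<in> {1..m}" "n \<noteq> p" "n \<noteq> cyc_add m p 1" by blast
    then have "Inl n \<in> G_block m p" "Inr n \<in> G_block m p"
      by (auto simp: G_block_def ground_def)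
    moreover have "\<not> (Inl n \<in> F_block m J \<and> Inr n \<in> F_block m J)"
      by (auto simp: F_block_def)
    ultimately show ?thesis by blast
  qed
  have GG: "p = q" if "p \<in> {1..m}" "q \<in> {1..m}" "G_block m p \<subseteq> G_block m q" for p q
  proof (rule ccontr)
    assume "p \<noteq> q"
    then have "Inl q \<in> G_block m p" using that(2) by (auto simp: G_block_def ground_def)
    moreover have "Inl q \<notin> G_block m q" by (simp add: G_block_def)
    ultimately show False using that(3) by blast
  qed
  have "finite (ground m)" by (simp add: ground_def)
  moreover have "\<A> \<union> G m \<subseteq> Pow (ground m)"
  proof -
    have "F_block m J \<in> Pow (ground m)" if "J \<subseteq> {1..m}" for J
      using that by (auto simp: F_block_def ground_def)
    then have "{F_block m J | J. J \<subseteq> {1..m}} \<subseteq> Pow (ground m)" by blast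
    moreover have "G_block m p \<in> Pow (ground m)" for p
      unfolding G_block_def by blast
    then have "G m \<subseteq> Pow (ground m)" unfolding G_def by blast
    ultimately show ?thesis using sub by (meson Un_least order_trans)
  qed
  moreover have "S = T" if S: "S \<in> \<A> \<union> G m" and T: "T \<in> \<A> \<union> G m" and "S \<subseteq> T" for S T
  proof -
    have blocks: "U \<in> F_block m ` Pow {1..m} \<or> U \<in> G_block m ` {1..m}" if "U \<in> \<A> \<union> G m" for U
    proof (cases "U \<in> G m")
      case True
      then show ?thesis unfolding G_def by (auto simp: image_iff)
    next
      case False
      then have "U \<in> {F_block m J | J. J \<subseteq> {1..m}}" using that sub by (meson UnE subsetD)
      then show ?thesis by auto
    qed
    from blocks[OF S] show ?thesis
    proof
      assume "S \<in> F_block m ` Pow {1..m}"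
      then obtain J where J: "J \<subseteq> {1..m}" "S = F_block m J" by blast
      have "T \<notin> G_block m ` {1..m}" using FG \<open>S \<subseteq> T\<close> J(2) by blast
      then obtain K where K: "K \<subseteq> {1..m}" "T = F_block m K" using blocks[OF T] by blast
      have "J = K" using \<open>S \<subseteq> T\<close> unfolding J(2) K(2) by (rule FF[OF J(1) K(1)])
      then show ?thesis using J(2) K(2) by simp
    next
      assume "S \<in> G_block m ` {1..m}"
      then obtain p where p: "p \<in> {1..m}" "S = G_block m p" by blast
      have "T \<notin> F_block m ` Pow {1..m}" using GF[OF p(1)] \<open>S \<subseteq> T\<close> p(2) by blast
      then obtain q where q: "q \<in> {1..m}" "T = G_block m q" using blocks[OF T] by blast
      have "p = q" using \<open>S \<subseteq> T\<close> unfolding p(2) q(2) by (rule GG[OF p(1) q(1)])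
      then show ?thesis using p(2) q(2) by simp
    qed
  qed
  ultimately show ?thesis
    unfolding sperner_system_def set_system_def by (intro conjI ballI impI)
qed

lemma sperner_system_M1: "m \<ge> 3 \<Longrightarrow> sperner_system (ground m) (M1 m)"
  unfolding M1_def by (rule sperner_system_blocks) (auto simp: F1_def)

lemma sperner_system_M2: "m \<ge> 3 \<Longrightarrow> sperner_system (ground m) (M2 m)"
  unfolding M2_def by (rule sperner_system_blocks) (auto simp: F2_def)

end

theory Submission imports Defs begin

text \<open>Let the degree of a point be the number of blocks containing it. In \<open>\<F>\<^sub>i\<close> every point lies in
  exactly half of the blocks, because toggling the membership in \<open>J\<close> of two elements preserves the
  parity of \<open>|J|\<close>. An unprimed point is missed by one block of \<open>\<G>\<close> and a primed point by two, so the
  unprimed points are exactly those whose degree is not minimal, and an isomorphism must fix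
  \<open>[m]\<close> as a set. But \<open>[m] = F_[m]\<close> is a block of exactly one of the two systems.\<close>

section \<open>Degrees of points and their invariance under isomorphism\<close>

definition degree :: "'a set set \<Rightarrow> 'a \<Rightarrow> nat" where
  "degree \<A> x = card {S \<in> \<A>. x \<in> S}"

text \<open>Only comparisons of degrees enter, so this invariant can be determined without counting
  the blocks of \<open>F1 m\<close> or \<open>F2 m\<close>.\<close>

definition nonminimal :: "'a set \<Rightarrow> 'a set set \<Rightarrow> 'a set" where
  "nonminimal A \<A> = {x \<in> A. \<exists>y\<in>A. degree \<A> y < degree \<A> x}"

lemma degree_image:
  assumes "inj_on \<sigma> A" "\<A> \<subseteq> Pow A" "x \<in> A"
  shows "degree ((`) \<sigma> ` \<A>) (\<sigma> x) = degree \<A> x"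
proof -
  have "{T \<in> (`) \<sigma> ` \<A>. \<sigma> x \<in> T} = (`) \<sigma> ` {S \<in> \<A>. x \<in> S}"
  proof -
    have "\<sigma> x \<in> \<sigma> ` S \<longleftrightarrow> x \<in> S" if "S \<in> \<A>" for S
      using assms that by (intro inj_on_image_mem_iff) auto
    then show ?thesis by blast
  qed
  moreover have "inj_on ((`) \<sigma>) {S \<in> \<A>. x \<in> S}"
    using inj_on_image_Pow[OF assms(1)] by (rule inj_on_subset) (use assms(2) in auto)
  ultimately show ?thesis
    by (simp add: degree_def card_image)
qed

lemma nonminimal_image:
  assumes "inj_on \<sigma> A" "\<A> \<subseteq> Pow A"
  shows "nonminimal (\<sigma> ` A) ((`) \<sigma> ` \<A>) = \<sigma> ` nonminimal A \<A>"
proof -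
  have "nonminimal (\<sigma> ` A) ((`) \<sigma> ` \<A>)
      = \<sigma> ` {x \<in> A. \<exists>y\<in>A. degree ((`) \<sigma> ` \<A>) (\<sigma> y) < degree ((`) \<sigma> ` \<A>) (\<sigma> x)}"
    unfolding nonminimal_def by blast
  also have "\<dots> = \<sigma> ` nonminimal A \<A>"
    by (simp add: nonminimal_def degree_image[OF assms] cong: conj_cong)
  finally show ?thesis .
qed

lemma degree_Un_disjoint:
  assumes "finite \<A>" "finite \<B>" "\<A> \<inter> \<B> = {}"
  shows "degree (\<A> \<union> \<B>) x = degree \<A> x + degree \<B> x"
proof -
  have "{S \<in> \<A> \<union> \<B>. x \<in> S} = {S \<in> \<A>. x \<in> S} \<union> {S \<in> \<B>. x \<in> S}"
    by auto
  then show ?thesis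
    using assms card_Un_disjoint[of "{S \<in> \<A>. x \<in> S}" "{S \<in> \<B>. x \<in> S}"]
    by (auto simp: degree_def)
qed

section \<open>Degrees in the families of blocks \<open>F_block m J\<close> with prescribed
  parity\<close>

definition parity_sets :: "nat \<Rightarrow> bool \<Rightarrow> nat set set" where
  "parity_sets m b = {J. J \<subseteq> {1..m} \<and> even (card J) = b}"

text \<open>With the parity as a Boolean parameter, \<open>False\<close> for odd and
  \<open>True\<close> for even, one set of lemmas serves both systems.\<close>

lemma F1_eq: "F1 m = F_block m ` parity_sets m False"
  by (auto simp: F1_def parity_sets_def)

lemma F2_eq: "F2 m = F_block m ` parity_sets m True"
  by (auto simp: F2_def parity_sets_def)

lemma finite_parity_sets: "finite (parity_sets m b)"
  by (rule finite_subset[of _ "Pow {1..m}"]) (auto simp: parity_sets_def)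

lemma Inl_in_F_block [simp]: "Inl i \<in> F_block m J \<longleftrightarrow> i \<in> J"
  by (auto simp: F_block_def)

lemma Inr_in_F_block [simp]: "Inr i \<in> F_block m J \<longleftrightarrow> i \<in> {1..m} \<and> i \<notin> J"
  by (auto simp: F_block_def)

lemma inj_F_block: "inj (F_block m)"
proof (rule injI)
  fix J K assume "F_block m J = F_block m K"
  then have "Inl x \<in> F_block m J \<longleftrightarrow> Inl x \<in> F_block m K" for x by simp
  then show "J = K" by auto
qed

definition toggle :: "'a \<Rightarrow> 'a set \<Rightarrow> 'a set" where
  "toggle i J = (if i \<in> J then J - {i} else insert i J)"

lemma even_card_toggle:
  assumes "finite J"
  shows "even (card (toggle i J)) \<longleftrightarrow> odd (card J)"
proof (cases "i \<in> J")
  case True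
  with assms have "card J = Suc (card (J - {i}))"
    by (rule card.remove)
  with True show ?thesis by (simp add: toggle_def)
qed (use assms in \<open>simp add: toggle_def\<close>)

lemma toggle_parity_sets:
  assumes "i \<in> {1..m}" "J \<in> parity_sets m b"
  shows "toggle i J \<in> parity_sets m (\<not> b)"
proof -
  have "finite J"
    using assms(2) finite_subset[of J "{1..m}"] by (simp add: parity_sets_def)
  moreover have "toggle i J \<subseteq> {1..m}"
    using assms by (auto simp: parity_sets_def toggle_def)
  ultimately show ?thesis
    using assms(2) by (auto simp: parity_sets_def even_card_toggle)
qed

lemma card_parity_sets_mem:
  assumes "m \<ge> 2" "i \<in> {1..m}"
  shows "card {J \<in> parity_sets m b. i \<in> J} = card {J \<in> parity_sets m b. i \<notin> J}"
proof -
  \<comment> \<open>Any element of \<open>{1..m}\<close> other than \<open>i\<close> would do.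
    Toggling \<open>i\<close> and \<open>k\<close> together keeps the parity, swaps the two families
    and is its own inverse.\<close>
  define k where "k = (if i = 1 then 2 else 1 :: nat)"
  have k: "k \<in> {1..m}" "k \<noteq> i"
    using assms by (auto simp: k_def)
  have par: "toggle k (toggle i J) \<in> parity_sets m b" if "J \<in> parity_sets m b" for J
    using toggle_parity_sets[OF k(1) toggle_parity_sets[OF assms(2) that]] by simp
  have mem: "i \<in> toggle k (toggle i J) \<longleftrightarrow> i \<notin> J" for J
    using k(2) by (auto simp: toggle_def)
  have inv: "toggle k (toggle i (toggle k (toggle i J))) = J" for J
    using k(2) by (auto simp: toggle_def)
  have "bij_betw (\<lambda>J. toggle k (toggle i J)) {J \<in> parity_sets m b. i \<in> J}
      {J \<in> parity_sets m b. i \<notin> J}"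
    by (rule bij_betw_byWitness[where f' = "\<lambda>J. toggle k (toggle i J)"])
      (use par mem inv in auto)
  then show ?thesis by (rule bij_betw_same_card)
qed

text \<open>The blocks through \<open>Inl i\<close> come from the \<open>J\<close> containing
  \<open>i\<close>, those through \<open>Inr i\<close> from the \<open>J\<close> avoiding
  \<open>i\<close>, and these two classes are equally large. The factor 2 avoids division in
  \<open>nat\<close>.\<close>

lemma degree_F_blocks:
  assumes "m \<ge> 2" "x \<in> ground m"
  shows "2 * degree (F_block m ` parity_sets m b) x = card (parity_sets m b)"
proof -
  have "{S \<in> F_block m ` parity_sets m b. x \<in> S}
      = F_block m ` {J \<in> parity_sets m b. x \<in> F_block m J}"
    by auto
  then have deg: "degree (F_block m ` parity_sets m b) x
      = card {J \<in> parity_sets m b. x \<in> F_block m J}"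
    by (simp add: degree_def card_image inj_on_subset[OF inj_F_block])
  obtain i where i: "i \<in> {1..m}" and x: "x = Inl i \<or> x = Inr i"
    using assms(2) by (auto simp: ground_def)
  have "card (parity_sets m b)
      = card ({J \<in> parity_sets m b. i \<in> J} \<union> {J \<in> parity_sets m b. i \<notin> J})"
    by (rule arg_cong[where f = card]) auto
  also have "\<dots> = card {J \<in> parity_sets m b. i \<in> J} + card {J \<in> parity_sets m b. i \<notin> J}"
    using finite_parity_sets by (intro card_Un_disjoint) auto
  finally show ?thesis
    using deg x i card_parity_sets_mem[OF assms(1) i] by auto
qed

section \<open>Degrees in \<open>G m\<close>\<close>

lemma Inl_in_G_block [simp]: "Inl i \<in> G_block m p \<longleftrightarrow> i \<in> {1..m} \<and> i \<noteq> p"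
  by (auto simp: G_block_def ground_def)

text \<open>\<open>cyc_add m p 1\<close> unfolds to \<open>p mod m + 1\<close>, the cyclic
  successor, which sends \<open>m\<close> to 1.\<close>

lemma Inr_in_G_block [simp]:
  "Inr i \<in> G_block m p \<longleftrightarrow> i \<in> {1..m} \<and> i \<noteq> p \<and> i \<noteq> p mod m + 1"
  by (auto simp: G_block_def ground_def cyc_add_def)

lemma G_eq: "G m = G_block m ` {1..m}"
  by (auto simp: G_def)

text \<open>For \<open>p\<close> in \<open>{1..m}\<close>, the only unprimed point of the ground set
  missing from \<open>G_block m p\<close> is \<open>Inl p\<close>, so the block determines its
  index.\<close>

lemma inj_on_G_block: "inj_on (G_block m) {1..m}"
proof (rule inj_onI)
  fix p q assume p: "p \<in> {1..m}" and eq: "G_block m p = G_block m q"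
  have "Inl p \<notin> G_block m q"
    unfolding eq[symmetric] by simp
  with p show "p = q" by simp
qed

lemma degree_G: "degree (G m) x = card {p \<in> {1..m}. x \<in> G_block m p}"
proof -
  have "{S \<in> G m. x \<in> S} = G_block m ` {p \<in> {1..m}. x \<in> G_block m p}"
    by (auto simp: G_eq)
  moreover have "inj_on (G_block m) {p \<in> {1..m}. x \<in> G_block m p}"
    by (rule inj_on_subset[OF inj_on_G_block]) auto
  ultimately show ?thesis
    by (simp add: degree_def card_image)
qed

lemma degree_G_Inl:
  assumes "i \<in> {1..m}"
  shows "degree (G m) (Inl i) = m - 1"
proof -
  have "{p \<in> {1..m}. Inl i \<in> G_block m p} = {1..m} - {i}"
    using assms by auto
  with assms show ?thesis by (simp add: degree_G)
qed

lemma degree_G_Inr: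
  assumes "m \<ge> 2" "i \<in> {1..m}"
  shows "degree (G m) (Inr i) = m - 2"
proof -
  \<comment> \<open>The cyclic predecessor of \<open>i\<close>: \<open>Inr i\<close> is missed
    exactly by the blocks with index \<open>i\<close> or \<open>q\<close>, and these differ because
    \<open>m \<ge> 2\<close>.\<close>
  define q where "q = (if i = 1 then m else i - 1)"
  have q: "q \<in> {1..m}" "q \<noteq> i"
    using assms by (auto simp: q_def)
  have pred: "i = p mod m + 1 \<longleftrightarrow> p = q" if "p \<in> {1..m}" for p
    \<comment> \<open>The case \<open>p = m\<close> is the wraparound; otherwise
      \<open>p mod m = p\<close>.\<close>
    using assms that by (cases "p = m") (auto simp: q_def)
  have "{p \<in> {1..m}. Inr i \<in> G_block m p} = {p \<in> {1..m}. p \<noteq> i \<and> i \<noteq> p mod m + 1}"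
    using assms(2) by auto
  also have "\<dots> = {1..m} - {i, q}"
    using pred by blast
  finally have "{p \<in> {1..m}. Inr i \<in> G_block m p} = {1..m} - {i, q}" .
  with assms q show ?thesis by (simp add: degree_G card_Diff_subset)
qed

section \<open>The unprimed points as an invariant set\<close>

lemma F_block_notin_G: "F_block m J \<notin> G m"
proof
  assume "F_block m J \<in> G m"
  then obtain p where p: "p \<in> {1..m}" "F_block m J = G_block m p"
    by (auto simp: G_eq)
  \<comment> \<open>For \<open>p\<close> in \<open>{1..m}\<close>, an F-block contains exactly one
    of \<open>Inl p\<close> and \<open>Inr p\<close>, whereas \<open>G_block m p\<close> contains
    neither.\<close>
  then have "Inl p \<notin> F_block m J" "Inr p \<notin> F_block m J" by simp_all
  with p(1) show False by simp
qed

text \<open>The F-blocks add the same amount to every degree, so only the degrees in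
  \<open>G m\<close> decide: \<open>m - 1\<close> at unprimed points and \<open>m - 2\<close> at
  primed ones. The set of unprimed points is written as \<open>F_block m {1..m}\<close> because it
  is also a candidate block.\<close>

lemma nonminimal_F_blocks_Un_G:
  assumes "m \<ge> 2"
  shows "nonminimal (ground m) (F_block m ` parity_sets m b \<union> G m) = F_block m {1..m}"
proof -
  define \<M> where "\<M> = F_block m ` parity_sets m b \<union> G m"
  have deg: "2 * degree \<M> x = card (parity_sets m b) + 2 * degree (G m) x"
    if "x \<in> ground m" for x
  proof -
    have "F_block m ` parity_sets m b \<inter> G m = {}"
      using F_block_notin_G by auto
    then have "degree \<M> x = degree (F_block m ` parity_sets m b) x + degree (G m) x"
      unfolding \<M>_def using finite_parity_sets
      by (intro degree_Un_disjoint) (auto simp: G_eq)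
    then show ?thesis
      using degree_F_blocks[OF assms that, of b] by simp
  qed
  have less: "degree \<M> y < degree \<M> x \<longleftrightarrow> degree (G m) y < degree (G m) x"
    if "x \<in> ground m" "y \<in> ground m" for x y
    using deg[OF that(1)] deg[OF that(2)] by linarith
  have "nonminimal (ground m) \<M>
      = {x \<in> ground m. \<exists>y\<in>ground m. degree (G m) y < degree (G m) x}"
    using less by (auto simp: nonminimal_def)
  also have "\<dots> = F_block m {1..m}"
  proof (intro set_eqI iffI)
    fix x assume "x \<in> F_block m {1..m}"
    then obtain i where i: "i \<in> {1..m}" "x = Inl i"
      by (auto simp: F_block_def)
    then have "degree (G m) (Inr i) < degree (G m) x" "Inr i \<in> ground m" "x \<in> ground m"
      using assms by (auto simp: degree_G_Inl degree_G_Inr ground_def)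
    then show "x \<in> {x \<in> ground m. \<exists>y\<in>ground m. degree (G m) y < degree (G m) x}"
      by blast
  next
    fix x assume "x \<in> {x \<in> ground m. \<exists>y\<in>ground m. degree (G m) y < degree (G m) x}"
    then show "x \<in> F_block m {1..m}"
      using assms by (auto simp: ground_def degree_G_Inl degree_G_Inr)
  qed
  finally show ?thesis by (simp add: \<M>_def)
qed

text \<open>No F-block lies in \<open>G m\<close> and \<open>F_block m\<close> is injective, so the
  question is whether \<open>{1..m}\<close>, of cardinality \<open>m\<close>, has the prescribed
  parity.\<close>

lemma F_block_full_mem_iff:
  "F_block m {1..m} \<in> F_block m ` parity_sets m b \<union> G m \<longleftrightarrow> even m = b"
  using F_block_notin_G by (auto simp: inj_image_mem_iff[OF inj_F_block] parity_sets_def)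

theorem proposition3p13:
  fixes m :: nat
  assumes "m \<ge> 3"
  shows "\<not> isomorphic_systems (ground m) (M1 m) (ground m) (M2 m)"
proof
  assume "isomorphic_systems (ground m) (M1 m) (ground m) (M2 m)"
  then obtain \<sigma> where \<sigma>: "bij_betw \<sigma> (ground m) (ground m)"
    and img: "{\<sigma> ` S | S. S \<in> M1 m} = M2 m"
    by (auto simp: isomorphic_systems_def)
  have M2: "(`) \<sigma> ` M1 m = M2 m"
    by (auto simp: img[symmetric])
  have inj: "inj_on \<sigma> (ground m)" and surj: "\<sigma> ` ground m = ground m"
    using \<sigma> by (auto simp: bij_betw_def)
  have sub: "M1 m \<subseteq> Pow (ground m)"
    using sperner_system_M1[OF assms] by (simp add: sperner_system_def set_system_def)
  let ?U = "F_block m {1..m}"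
  have U1: "nonminimal (ground m) (M1 m) = ?U" and U2: "nonminimal (ground m) (M2 m) = ?U"
    using assms by (simp_all add: M1_def M2_def F1_eq F2_eq nonminimal_F_blocks_Un_G)
  have fix_U: "\<sigma> ` ?U = ?U"
    using nonminimal_image[OF inj sub] by (simp add: surj M2 U1 U2)
  have "?U \<subseteq> ground m"
    by (auto simp: F_block_def ground_def)
  \<comment> \<open>Taking images under \<sigma> is injective on subsets of the ground set, so no
    other block of \<open>M1 m\<close> can have the same image as \<open>?U\<close>.\<close>
  then have "\<sigma> ` ?U \<in> (`) \<sigma> ` M1 m \<longleftrightarrow> ?U \<in> M1 m"
    using sub by (intro inj_on_image_mem_iff[OF inj_on_image_Pow[OF inj]]) auto
  then have "?U \<in> M2 m \<longleftrightarrow> ?U \<in> M1 m"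
    by (simp only: fix_U M2)
  \<comment> \<open>The two memberships amount to \<open>even m = True\<close> and
    \<open>even m = False\<close>, which cannot be equivalent.\<close>
  then show False
    unfolding M1_def M2_def F1_eq F2_eq F_block_full_mem_iff by simp
qed

end
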